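(* Let $d, K \ge 1$ be integers and $\sigma \ge 0$, $L \ge 0$ real numbers. Fix an image $v$, and let $C_1(v),\dots,C_K(v)$ be i.i.d. random (semantics-preserving) perturbed views of $v$. Let $z_k = F_\alpha(V_\theta(C_k(v))) \in \mathbb{R}^d$, $k=1,\dots,K$, be their embeddings, which are then i.i.d. random vectors in $\mathbb{R}^d$, with common mean $\mu_v = \mathbb{E}[z_1]$ and covariance satisfying $\operatorname{Cov}[z_1] \preceq \sigma^2 I_d$. Then the anchor $\bar z = \frac{1}{K}\sum_{k=1}^{K} z_k$ satisfies $$\mathbb{E}\,\|\bar z - \mu_v\|_2^2 \;\le\; \frac{d\,\sigma^2}{K}.$$ Suppose further that the decoder's conditional output distribution is $L$-Lipschitz in the visual embedding under total variation, i.e. $\mathrm{TV}\big(p_\beta(\cdot\mid z),\, p_\beta(\cdot\mid z')\big) \le L\,\|z - z'\|_2$ for all $z, z' \in \mathbb{R}^d$. Then for any set $\mathcal{H}$ of responses (the "hallucinatory" responses) and any embedding $z \in \mathbb{R}^d$, $$\left|\,\Pr_{p_\beta(\cdot\mid z)}[\mathcal{H}] - \Pr_{p_\beta(\cdot\mid \mu_v)}[\mathcal{H}]\,\right| \;\le\; L\,\|z - \mu_v\|_2 .$$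
   Context: $V_\theta$ (the vision encoder) and $F_\alpha$ (the projector) are fixed deterministic (measurable) maps; the composition $F_\alpha \circ V_\theta$ sends an image to a vector in $\mathbb{R}^d$, called its visual embedding. A perturbed view $C_k(v)$ is a random image obtained from $v$ (for instance by random masking); the phrase "semantics-preserving" is descriptive and imposes no further mathematical condition beyond those stated. The mean and covariance of $z_1$ are assumed to exist. For each $z \in \mathbb{R}^d$, $p_\beta(\cdot \mid z)$ is a probability distribution on the set of possible responses (text sequences, i.e. finite token sequences over a finite vocabulary, a countable discrete set): the decoder's conditional output distribution given visual embedding $z$. $\Pr_{p_\beta(\cdot\mid z)}[\mathcal{H}]$ is the probability that $p_\beta(\cdot\mid z)$ assigns to the set $\mathcal{H}$. $\mathrm{TV}(P,Q) = \sup_{A} |P(A) - Q(A)|$ is the total variation distance, the supremum being over all events $A$. $\preceq$ is the Loewner (positive semidefinite) order on symmetric matrices, $I_d$ is the $d \times d$ identity matrix, and $\|\cdot\|_2$ is the Euclidean norm. *)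

theory Defs
  imports "HOL-Probability.Probability"
begin

definition iid_vars :: "'w measure \<Rightarrow> 'b measure \<Rightarrow> ('i \<Rightarrow> 'w \<Rightarrow> 'b) \<Rightarrow> 'i set \<Rightarrow> bool" where
  "iid_vars M N X I \<longleftrightarrow>
     prob_space.indep_vars M (\<lambda>_. N) X I \<and>
     (\<forall>i\<in>I. \<forall>j\<in>I. distr M N (X i) = distr M N (X j))"

(* The Bochner integral is 0 on non-integrable functions, so existence of the mean and
   of the covariance entries has to be required separately from their values. *)
definition has_mean_and_cov :: "'w measure \<Rightarrow> ('w \<Rightarrow> real ^ 'n) \<Rightarrow> bool" where
  "has_mean_and_cov M X \<longleftrightarrow>
     integrable M X \<and>
     (\<forall>i j. integrable M (\<lambda>w. (X w $ i - integral\<^sup>L M X $ i) * (X w $ j - integral\<^sup>L M X $ j)))"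

definition cov_matrix :: "'w measure \<Rightarrow> ('w \<Rightarrow> real ^ 'n) \<Rightarrow> real ^ 'n ^ 'n" where
  "cov_matrix M X =
     (\<chi> i j. integral\<^sup>L M
        (\<lambda>w. (X w $ i - integral\<^sup>L M X $ i) * (X w $ j - integral\<^sup>L M X $ j)))"

definition pos_semidef :: "real ^ 'n ^ 'n \<Rightarrow> bool" where
  "pos_semidef A \<longleftrightarrow> transpose A = A \<and> (\<forall>x. 0 \<le> x \<bullet> (A *v x))"

definition loewner_le :: "real ^ 'n ^ 'n \<Rightarrow> real ^ 'n ^ 'n \<Rightarrow> bool" where
  "loewner_le A B \<longleftrightarrow> transpose A = A \<and> transpose B = B \<and> pos_semidef (B - A)"

definition tv_dist :: "'a pmf \<Rightarrow> 'a pmf \<Rightarrow> real" where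
  "tv_dist P Q = (SUP A. \<bar>measure_pmf.prob P A - measure_pmf.prob Q A\<bar>)"

end

theory Submission
  imports Defs
begin

text \<open>The squared norm splits into coordinates, and each coordinate of \<open>zbar\<close> is
  a sample mean of K i.i.d. real variables. Its mean square error is one K-th of the variance,
  because the cross terms of centered independent variables vanish
  (\<open>indep_centered_square_sum\<close>, \<open>mean_square_error_sample_mean\<close>). The
  variance of coordinate i is a diagonal entry of the covariance matrix, and the Loewner bound caps
  it at \<sigma>^2 (\<open>loewner_le_diag\<close>). Adding up d coordinates gives the first claim.
  The decoder claim is separate: total variation is a supremum over events, so it dominates the
  difference at \<open>H\<close> (\<open>prob_diff_le_tv_dist\<close>), and the Lipschitz hypothesis
  bounds it at the pair \<open>x\<close>, \<mu>.\<close>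

lemma (in prob_space) indep_vars_integral_mult:
  fixes Y :: "'i \<Rightarrow> 'a \<Rightarrow> real"
  assumes "indep_vars (\<lambda>_. borel) Y I" "k \<in> I" "l \<in> I" "k \<noteq> l"
    and "integrable M (Y k)" "integrable M (Y l)"
  shows "integrable M (\<lambda>w. Y k w * Y l w)"
    and "expectation (\<lambda>w. Y k w * Y l w) = expectation (Y k) * expectation (Y l)"
proof -
  \<comment> \<open>The rules for products of independent variables range over a finite index set;
    over \<open>{k, l}\<close> with distinct indices that product has exactly the two wanted
    factors.\<close>
  have ind: "indep_vars (\<lambda>_. borel) Y {k, l}"
    using assms by (intro indep_vars_subset[OF assms(1)]) auto
  have int: "\<And>i. i \<in> {k, l} \<Longrightarrow> integrable M (Y i)" using assms by auto
  show "integrable M (\<lambda>w. Y k w * Y l w)"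
    using indep_vars_integrable[OF _ ind int] assms(4) by simp
  show "expectation (\<lambda>w. Y k w * Y l w) = expectation (Y k) * expectation (Y l)"
    using indep_vars_lebesgue_integral[OF _ ind int] assms(4) by simp
qed

text \<open>The square expands into a double sum. Off the diagonal, independence makes the products
  integrable and factors their expectations into products of zero means, so only the diagonal
  survives.\<close>

lemma (in prob_space) indep_centered_square_sum:
  fixes Y :: "'i \<Rightarrow> 'a \<Rightarrow> real"
  assumes "finite I" and ind: "indep_vars (\<lambda>_. borel) Y I"
    and int: "\<And>k. k \<in> I \<Longrightarrow> integrable M (Y k)"
    and sq: "\<And>k. k \<in> I \<Longrightarrow> integrable M (\<lambda>w. (Y k w)\<^sup>2)"
    and mean: "\<And>k. k \<in> I \<Longrightarrow> expectation (Y k) = 0"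
  shows "integrable M (\<lambda>w. (\<Sum>k\<in>I. Y k w)\<^sup>2)"
    and "expectation (\<lambda>w. (\<Sum>k\<in>I. Y k w)\<^sup>2) = (\<Sum>k\<in>I. expectation (\<lambda>w. (Y k w)\<^sup>2))"
proof -
  have expand: "(\<Sum>k\<in>I. Y k w)\<^sup>2 = (\<Sum>k\<in>I. \<Sum>l\<in>I. Y k w * Y l w)" for w
    by (simp add: power2_eq_square sum_product)
  have prod_int: "integrable M (\<lambda>w. Y k w * Y l w)" if "k \<in> I" "l \<in> I" for k l
    using that sq[of k] int indep_vars_integral_mult(1)[OF ind that]
    by (cases "k = l") (auto simp: power2_eq_square)
  have prod_exp: "expectation (\<lambda>w. Y k w * Y l w) = (if k = l then expectation (\<lambda>w. (Y k w)\<^sup>2) else 0)"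
    if "k \<in> I" "l \<in> I" for k l
    using that int mean indep_vars_integral_mult(2)[OF ind that]
    by (auto simp: power2_eq_square)
  show "integrable M (\<lambda>w. (\<Sum>k\<in>I. Y k w)\<^sup>2)"
    unfolding expand by (intro Bochner_Integration.integrable_sum prod_int)
  show "expectation (\<lambda>w. (\<Sum>k\<in>I. Y k w)\<^sup>2) = (\<Sum>k\<in>I. expectation (\<lambda>w. (Y k w)\<^sup>2))"
    unfolding expand
    by (simp add: Bochner_Integration.integral_sum Bochner_Integration.integrable_sum
        prod_int prod_exp \<open>finite I\<close>)
qed

text \<open>Both sides are integrals of \<open>g\<close> against the same law on \<open>N\<close>.
  This carries moment assumptions from one sample to all the others.\<close>

lemma distr_eq_integral_transfer:
  fixes g :: "'b \<Rightarrow> real"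
  assumes "X \<in> measurable M N" "Y \<in> measurable M N" "distr M N X = distr M N Y"
    and "g \<in> borel_measurable N"
  shows "integrable M (\<lambda>w. g (X w)) \<longleftrightarrow> integrable M (\<lambda>w. g (Y w))"
    and "integral\<^sup>L M (\<lambda>w. g (X w)) = integral\<^sup>L M (\<lambda>w. g (Y w))"
  using assms integrable_distr_eq[of _ M N g] integral_distr[of _ M N g] by metis+

text \<open>The error is a sum of independent centered variables divided by \<open>card I\<close>.
  The samples \<open>X k\<close> live in an arbitrary space \<open>N\<close> and enter through a
  real function \<open>f\<close>, so that independence of the views can be used directly; moments
  are assumed only at a reference index \<open>j\<close>.\<close>

lemma (in prob_space) mean_square_error_sample_mean:
  fixes f :: "'b \<Rightarrow> real"
  assumes iid: "iid_vars M N X I" and "finite I" and "j \<in> I"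
    and f: "f \<in> borel_measurable N"
    and int: "integrable M (\<lambda>w. f (X j w))"
    and sq: "integrable M (\<lambda>w. (f (X j w) - m)\<^sup>2)"
    and m: "m = expectation (\<lambda>w. f (X j w))"
  shows "integrable M (\<lambda>w. ((\<Sum>k\<in>I. f (X k w)) / card I - m)\<^sup>2)"
    and "expectation (\<lambda>w. ((\<Sum>k\<in>I. f (X k w)) / card I - m)\<^sup>2)
         = expectation (\<lambda>w. (f (X j w) - m)\<^sup>2) / card I"
proof -
  have ind: "indep_vars (\<lambda>_. N) X I"
    and distr_eq: "\<And>k. k \<in> I \<Longrightarrow> distr M N (X k) = distr M N (X j)"
    using iid \<open>j \<in> I\<close> unfolding iid_vars_def by blast+
  have X: "X k \<in> measurable M N" if "k \<in> I" for k
    using ind that unfolding indep_vars_def2 by blast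
  note transfer = distr_eq_integral_transfer[OF X X[OF \<open>j \<in> I\<close>] distr_eq]
  define Y where "Y k w = f (X k w) - m" for k w
  have Y_ind: "indep_vars (\<lambda>_. borel) Y I"
    unfolding Y_def using f by (intro indep_vars_compose2[OF ind]) simp
  have fX: "integrable M (\<lambda>w. f (X k w))" "expectation (\<lambda>w. f (X k w)) = m" if "k \<in> I" for k
    using transfer[OF that that f] int m by auto
  have g: "(\<lambda>x. (f x - m)\<^sup>2) \<in> borel_measurable N" using f by measurable
  have Y_int: "integrable M (Y k)" and Y_mean: "expectation (Y k) = 0" if "k \<in> I" for k
    using fX[OF that] by (auto simp: Y_def[abs_def] prob_space)
  have Y_sq: "integrable M (\<lambda>w. (Y k w)\<^sup>2)"
    and Y_var: "expectation (\<lambda>w. (Y k w)\<^sup>2) = expectation (\<lambda>w. (f (X j w) - m)\<^sup>2)" if "k \<in> I" for k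
    using transfer[OF that that g] sq by (auto simp: Y_def)
  have pos: "card I > 0" using assms(2,3) card_gt_0_iff by blast
  \<comment> \<open>As \<open>card I\<close> is nonzero, \<open>m\<close> is the average of
    \<open>card I\<close> copies of itself and can be moved inside the sum.\<close>
  have eq: "((\<Sum>k\<in>I. f (X k w)) / card I - m)\<^sup>2 = (\<Sum>k\<in>I. Y k w)\<^sup>2 / (card I)\<^sup>2" for w
    using pos by (simp add: Y_def sum_subtractf field_simps flip: power_divide)
  note sum = indep_centered_square_sum[OF \<open>finite I\<close> Y_ind Y_int Y_sq Y_mean]
  show "integrable M (\<lambda>w. ((\<Sum>k\<in>I. f (X k w)) / card I - m)\<^sup>2)"
    unfolding eq using sum(1) by simp
  show "expectation (\<lambda>w. ((\<Sum>k\<in>I. f (X k w)) / card I - m)\<^sup>2)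
         = expectation (\<lambda>w. (f (X j w) - m)\<^sup>2) / card I"
    unfolding eq using sum(2) pos by (simp add: Y_var power2_eq_square[of "real (card I)"])
qed

text \<open>The quadratic form of \<open>B - A\<close> at the i-th basis vector is its i-th diagonal
  entry.\<close>

lemma loewner_le_diag:
  fixes A B :: "real ^ 'n ^ 'n"
  assumes "loewner_le A B"
  shows "A $ i $ i \<le> B $ i $ i"
proof -
  have "0 \<le> axis i 1 \<bullet> ((B - A) *v axis i 1)"
    using assms unfolding loewner_le_def pos_semidef_def by blast
  then show ?thesis
    by (simp add: inner_axis' matrix_vector_mult_basis column_def)
qed

lemma prob_diff_le_tv_dist:
  "\<bar>measure_pmf.prob P A - measure_pmf.prob Q A\<bar> \<le> tv_dist P Q"
proof -
  \<comment> \<open>A supremum of reals is known to dominate its members only if the family is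
    bounded above, hence the bound by 1.\<close>
  have "\<bar>measure_pmf.prob P A - measure_pmf.prob Q A\<bar> \<le> 1" for A
    using measure_pmf.prob_le_1[of P A] measure_pmf.prob_le_1[of Q A]
      measure_nonneg[of P A] measure_nonneg[of Q A] by linarith
  then show ?thesis
    unfolding tv_dist_def by (intro cSUP_upper) (auto intro!: bdd_aboveI2)
qed

theorem proposition3p1:
  fixes M :: "'w measure"
    and Img :: "'img measure" and Feat :: "'feat measure"
    and V :: "'img \<Rightarrow> 'feat" and F :: "'feat \<Rightarrow> real ^ 'd"
    and C :: "nat \<Rightarrow> 'img \<Rightarrow> 'w \<Rightarrow> 'img" and v :: 'img
    and z :: "nat \<Rightarrow> 'w \<Rightarrow> real ^ 'd" and \<mu> :: "real ^ 'd" and zbar :: "'w \<Rightarrow> real ^ 'd"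
    and p :: "real ^ 'd \<Rightarrow> ('tok :: finite) list pmf"
    and K :: nat and \<sigma> L :: real
  assumes "prob_space M"
    and "K \<ge> 1" and "\<sigma> \<ge> 0" and "L \<ge> 0"
    and "V \<in> measurable Img Feat" and "F \<in> borel_measurable Feat"
    and "v \<in> space Img"
    and "iid_vars M Img (\<lambda>k. C k v) {1..K}"
    and "\<And>k w. z k w = F (V (C k v w))"
    and "has_mean_and_cov M (z 1)"
    and "\<mu> = integral\<^sup>L M (z 1)"
    and "loewner_le (cov_matrix M (z 1)) (\<sigma>\<^sup>2 *\<^sub>R mat 1)"
    and "\<And>w. zbar w = (1 / real K) *\<^sub>R (\<Sum>k=1..K. z k w)"
  shows "(integrable M (\<lambda>w. (norm (zbar w - \<mu>))\<^sup>2) \<and>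
          integral\<^sup>L M (\<lambda>w. (norm (zbar w - \<mu>))\<^sup>2) \<le> real CARD('d) * \<sigma>\<^sup>2 / real K) \<and>
         ((\<forall>x y. tv_dist (p x) (p y) \<le> L * norm (x - y)) \<longrightarrow>
          (\<forall>(H :: 'tok list set) x.
             \<bar>measure_pmf.prob (p x) H - measure_pmf.prob (p \<mu>) H\<bar> \<le> L * norm (x - \<mu>)))"
proof -
  interpret prob_space M by fact
  have one: "(1::nat) \<in> {1..K}" using \<open>K \<ge> 1\<close> by simp
  have z1: "integrable M (z 1)"
    and cov: "integrable M (\<lambda>w. (z 1 w $ i - \<mu> $ i) * (z 1 w $ i - \<mu> $ i))" for i
    using assms(10) unfolding has_mean_and_cov_def assms(11) by auto
  have coord: "integrable M (\<lambda>w. (zbar w $ i - \<mu> $ i)\<^sup>2)"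
    "expectation (\<lambda>w. (zbar w $ i - \<mu> $ i)\<^sup>2) \<le> \<sigma>\<^sup>2 / K" for i
  proof -
    \<comment> \<open>The coordinate is read as a function of the raw view, since the i.i.d.
      assumption concerns \<open>C k v\<close> and not the embeddings.\<close>
    define f where "f x = F (V x) $ i" for x
    have f: "f \<in> borel_measurable Img"
      unfolding f_def
      by (intro borel_measurable_continuous_on[OF _ measurable_compose[OF assms(5,6)]] continuous_intros)
    have fC: "f (C k v w) = z k w $ i" for k w by (simp add: f_def assms(9))
    have mean: "\<mu> $ i = expectation (\<lambda>w. f (C 1 v w))"
      using z1 unfolding fC assms(11)
      by (simp add: integral_bounded_linear[OF bounded_linear_vec_nth])
    have int: "integrable M (\<lambda>w. f (C 1 v w))"
      unfolding fC by (rule integrable_bounded_linear[OF bounded_linear_vec_nth z1])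
    have sq: "integrable M (\<lambda>w. (f (C 1 v w) - \<mu> $ i)\<^sup>2)"
      unfolding fC power2_eq_square by (rule cov)
    have zbar: "zbar w $ i = (\<Sum>k\<in>{1..K}. f (C k v w)) / card {1..K}" for w
      by (simp add: fC assms(13))
    note mse = mean_square_error_sample_mean[OF assms(8) _ one f int sq mean]
    show "integrable M (\<lambda>w. (zbar w $ i - \<mu> $ i)\<^sup>2)"
      unfolding zbar using mse(1) by simp
    \<comment> \<open>The variance of the coordinate is a diagonal covariance entry, compared with
      the diagonal of \<sigma>^2 times the identity.\<close>
    have "expectation (\<lambda>w. (f (C 1 v w) - \<mu> $ i)\<^sup>2) = cov_matrix M (z 1) $ i $ i"
      by (simp add: fC cov_matrix_def assms(11) power2_eq_square)
    also have "\<dots> \<le> \<sigma>\<^sup>2"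
      using loewner_le_diag[OF assms(12), of i] by (simp add: mat_def)
    finally show "expectation (\<lambda>w. (zbar w $ i - \<mu> $ i)\<^sup>2) \<le> \<sigma>\<^sup>2 / K"
      unfolding zbar using mse(2) by (simp add: divide_right_mono)
  qed
  have norm_eq: "(norm (zbar w - \<mu>))\<^sup>2 = (\<Sum>i\<in>UNIV. (zbar w $ i - \<mu> $ i)\<^sup>2)" for w
    by (simp add: norm_vec_def L2_set_def sum_nonneg)
  \<comment> \<open>Without integrability the Bochner integral would be 0 and the bound would carry
    no information.\<close>
  have "integrable M (\<lambda>w. (norm (zbar w - \<mu>))\<^sup>2)"
    unfolding norm_eq using coord(1) by simp
  moreover have "expectation (\<lambda>w. (norm (zbar w - \<mu>))\<^sup>2) \<le> real CARD('d) * \<sigma>\<^sup>2 / real K"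
    unfolding norm_eq
    using sum_bounded_above[of UNIV "\<lambda>i. expectation (\<lambda>w. (zbar w $ i - \<mu> $ i)\<^sup>2)", OF coord(2)]
    by (simp add: Bochner_Integration.integral_sum coord(1))
  moreover have "\<bar>measure_pmf.prob (p x) H - measure_pmf.prob (p \<mu>) H\<bar> \<le> L * norm (x - \<mu>)"
    if "\<forall>x y. tv_dist (p x) (p y) \<le> L * norm (x - y)" for H x
    using that prob_diff_le_tv_dist order_trans by blast
  ultimately show ?thesis by blast
qed

end
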